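(* Fix a finite alphabet $\mathcal{X}\subset\mathbb{C}$ and consider the following communication model (a coherent-processing receiver with feedback-adapted displacement and on/off photon detection). A message $M_s$, uniformly distributed on $\{1,\dots,e^{NR}\}$, is encoded into a codeword $(X_1,\dots,X_N)\in\mathcal{X}^N$ satisfying the mean-photon-number constraint $\mathbb{E}[|X_i|^2]=\mathcal{E}$ for every $i$. In the $i$-th symbol period the receiver applies a complex control (displacement) signal $l_i=l_i(Y_1^{i-1})\in\mathbb{C}$, held constant over the symbol period and allowed to be an arbitrary function of the previous outputs $Y_1^{i-1}=(Y_1,\dots,Y_{i-1})$, and then observes the binary output $Y_i\in\{0,1\}$ (whether or not any photon arrives in the symbol period) with $$\Pr(Y_i=0\mid X_i,Y_1^{i-1})=e^{-|X_i+l_i(Y_1^{i-1})|^2},\qquad \Pr(Y_i=1\mid X_i,Y_1^{i-1})=1-e^{-|X_i+l_i(Y_1^{i-1})|^2},$$ conditionally independent of $(X_j)_{j\neq i}$. The decoder outputs an estimate $\hat M_s(Y_1^N)$. Let $C_{\sf coherent}(\mathcal{E})$ (in nats per channel use) be the supremum of rates $R$ for which there exist encoders, control policies and decoders with $\Pr(M_s\neq \hat M_s(Y_1^N))\to 0$ as $N\to\infty$. Then, as $\mathcal{E}\to 0$, $$\frac{C_{\sf coherent}(\mathcal{E})}{\mathcal{E}}\le \log\frac{1}{\mathcal{E}}-\log\log\frac{1}{\mathcal{E}}+O(1).$$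
   Context: $\log$ denotes the natural logarithm. $O(1)$ denotes a function of $\mathcal{E}$ that stays bounded as $\mathcal{E}\to 0$. Physically, $X_i$ is the complex amplitude of the coherent state $|X_i\rangle$ sent in the $i$-th channel use over a lossless optical channel (loss subsumed into $\mathcal{E}$), the receiver mixes it with a local coherent signal of amplitude $l_i$ so that the detected field has amplitude $X_i+l_i$, and an ideal photon counter produces Poisson-distributed counts with mean $|X_i+l_i|^2$; $Y_i$ records whether the count is zero or not. *)

theory Defs
  imports "HOL-Analysis.Analysis"
begin

text \<open>Binary output: False = no photon detected (Y = 0), True = at least one photon (Y = 1).
  A control policy is a function from the list of previous outputs (Y_1,...,Y_{i-1})
  to the displacement l_i; the length of the list determines the time index.\<close>

definition p_out :: "complex \<Rightarrow> complex \<Rightarrow> bool \<Rightarrow> real" where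
  "p_out x l y = (if y then 1 - exp (- (cmod (x + l))\<^sup>2) else exp (- (cmod (x + l))\<^sup>2))"

definition seq_prob :: "(nat \<Rightarrow> complex) \<Rightarrow> (bool list \<Rightarrow> complex) \<Rightarrow> bool list \<Rightarrow> real" where
  "seq_prob x l ys = (\<Prod>i<length ys. p_out (x i) (l (take i ys)) (ys ! i))"

definition num_msgs :: "nat \<Rightarrow> real \<Rightarrow> nat" where
  "num_msgs N R = nat \<lceil>exp (real N * R)\<rceil>"

definition valid_encoder :: "complex set \<Rightarrow> real \<Rightarrow> nat \<Rightarrow> nat \<Rightarrow> (nat \<Rightarrow> nat \<Rightarrow> complex) \<Rightarrow> bool" where
  "valid_encoder A E N Mn enc \<longleftrightarrow>
     (\<forall>m<Mn. \<forall>i<N. enc m i \<in> A) \<and>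
     (\<forall>i<N. (\<Sum>m<Mn. (cmod (enc m i))\<^sup>2) / real Mn = E)"

definition err_prob :: "nat \<Rightarrow> nat \<Rightarrow> (nat \<Rightarrow> nat \<Rightarrow> complex) \<Rightarrow> (bool list \<Rightarrow> complex)
      \<Rightarrow> (bool list \<Rightarrow> nat) \<Rightarrow> real" where
  "err_prob N Mn enc l dec =
     (\<Sum>m<Mn. \<Sum>ys\<in>{ys. length ys = N}. seq_prob (enc m) l ys * (if dec ys = m then 0 else 1))
       / real Mn"

definition achievable :: "complex set \<Rightarrow> real \<Rightarrow> real \<Rightarrow> bool" where
  "achievable A E R \<longleftrightarrow>
     (\<exists>enc :: nat \<Rightarrow> nat \<Rightarrow> nat \<Rightarrow> complex. \<exists>l :: nat \<Rightarrow> bool list \<Rightarrow> complex.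
      \<exists>dec :: nat \<Rightarrow> bool list \<Rightarrow> nat.
        (\<forall>\<^sub>F N in sequentially. valid_encoder A E N (num_msgs N R) (enc N)) \<and>
        ((\<lambda>N. err_prob N (num_msgs N R) (enc N) (l N) (dec N)) \<longlonglongrightarrow> 0))"

end

theory Submission
  imports Defs
begin

text \<open>Compare the output process with a reference law that ignores the codeword: given the
  displacement \<open>l\<close>, no photon is detected with probability \<open>(1 - E) e\<^sup>-\<^sup>|\<^sup>l\<^sup>|\<^sup>2\<close>.
  For a single use, the divergence of the true output law from it is a binary divergence, which a
  case analysis in \<open>|l|\<close> and \<open>|x + l|\<close> bounds by \<open>300 E + (ln (1/E) - ln ln (1/E) + 300) |x|\<^sup>2\<close>.
  The chain rule adds these bounds along the feedback-adapted output sequence, and the power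
  constraint turns the sum into \<open>N (300 E + (ln (1/E) - ln ln (1/E) + 300) E)\<close>.
  A change of measure in the style of Fano's inequality bounds \<open>(1 - P\<^sub>e) N R\<close> by this
  quantity plus \<open>2\<close>, and letting \<open>N \<rightarrow> \<infinity>\<close> gives \<open>R / E \<le> ln (1/E) - ln ln (1/E) + 600\<close>.\<close>

lemma one_minus_exp_minus_le: "1 - exp (- t) \<le> (t::real)"
  using exp_ge_add_one_self[of "-t"] by linarith

lemma mult_exp_minus_le_one_minus_exp: "u * exp (- u) \<le> 1 - exp (- (u::real))"
proof -
  have "exp (- u) * (1 + u) \<le> exp (- u) * exp u" by (intro mult_left_mono) auto
  thus ?thesis by (simp add: exp_minus field_simps)
qed

lemma exp_minus_diff_le:
  fixes a b :: real
  assumes "a \<le> b"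
  shows "exp (- a) - exp (- b) \<le> exp (- a) * (b - a)"
proof -
  have "exp (- a) - exp (- b) = exp (- a) * (1 - exp (- (b - a)))"
    by (simp add: exp_diff exp_minus field_simps)
  also have "\<dots> \<le> exp (- a) * (b - a)" by (intro mult_left_mono one_minus_exp_minus_le) auto
  finally show ?thesis .
qed

lemma minus_ln_one_minus_le:
  fixes E :: real
  assumes "0 < E" "E \<le> 1/2"
  shows "- ln (1 - E) \<le> 2 * E"
proof -
  have "ln (1 / (1 - E)) \<le> 1 / (1 - E) - 1" using assms by (intro ln_le_minus_one) simp
  moreover have "ln (1 / (1 - E)) = - ln (1 - E)" using assms by (simp add: ln_div)
  moreover have "1 / (1 - E) - 1 \<le> 2 * E" using assms by (simp add: field_simps)
  ultimately show ?thesis by linarith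
qed

lemma ln_le_div_add_ln_minus_one:
  fixes z k :: real
  assumes "0 < z" "0 < k"
  shows "ln z \<le> z / k + ln k - 1"
proof -
  have "ln (z / k) \<le> z / k - 1" using assms by (intro ln_le_minus_one) simp
  thus ?thesis using assms by (simp add: ln_div)
qed

lemma ln_power_two_le:
  fixes n :: nat
  shows "ln (2 ^ n :: real) \<le> n"
proof -
  have "ln (2 ^ n :: real) = n * ln 2" by (simp add: ln_realpow)
  also have "\<dots> \<le> n" using ln_2_less_1 by (simp add: mult_left_le)
  finally show ?thesis .
qed

lemma one_minus_exp_pade_le:
  fixes w :: real
  assumes "0 \<le> w"
  shows "(1 + w / 2) * (1 - exp (- w)) \<le> w"
proof -
  let ?f = "\<lambda>w::real. w - (1 + w / 2) * (1 - exp (- w))"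
  have "?f 0 \<le> ?f w"
  proof (rule DERIV_nonneg_imp_nondecreasing[OF assms])
    fix x :: real
    have "DERIV ?f x :> 1 - ((1/2) * (1 - exp (- x)) + (1 + x / 2) * exp (- x))"
      by (auto intro!: derivative_eq_intros)
    moreover have "(1 + x) * exp (- x) \<le> 1"
      using exp_ge_add_one_self[of x] by (simp add: exp_minus field_simps)
    hence "1 - ((1/2) * (1 - exp (- x)) + (1 + x / 2) * exp (- x)) \<ge> 0"
      by (simp add: field_simps)
    ultimately show "\<exists>y. DERIV ?f x :> y \<and> y \<ge> 0" by blast
  qed
  thus ?thesis by simp
qed

text \<open>With \<open>L = ln (1/E)\<close> and \<open>w = |x + l|\<^sup>2\<close>, this is where the \<open>- ln ln (1/E)\<close> term of the
  bound comes from: \<open>(1 - e\<^sup>-\<^sup>w) (L + ln w) / w\<close> never exceeds \<open>L - ln L + 1\<close>.\<close>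

lemma one_minus_exp_mult_ln_le:
  fixes w L :: real
  assumes "0 < w" "2 \<le> L"
  shows "(1 - exp (- w)) * (L + ln w) \<le> (L - ln L + 1) * w"
proof (cases "L + ln w \<le> 0")
  case True
  have "(1 - exp (- w)) * (L + ln w) \<le> 0" using True assms by (simp add: mult_nonneg_nonpos)
  also have "0 \<le> (L - ln L + 1) * w"
    using ln_le_div_add_ln_minus_one[of L 2] assms ln_2_less_1 by simp
  finally show ?thesis .
next
  case False
  have ln_L: "ln L \<le> L / 2" using ln_le_div_add_ln_minus_one[of L 2] assms ln_2_less_1 by simp
  have "ln (w * L) \<le> (w * L) / 4 + ln 4 - 1"
    using ln_le_div_add_ln_minus_one[of "w * L" 4] assms by simp
  moreover have "ln (4::real) \<le> 2" using ln_power_two_le[of 2] by simp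
  moreover have "ln (w * L) = ln w + ln L" using assms by (simp add: ln_mult)
  ultimately have "L + ln w \<le> L - ln L + 1 + (L / 2) * (w / 2)" by (simp add: mult.commute)
  also have "\<dots> \<le> L - ln L + 1 + (L - ln L + 1) * (w / 2)"
    using ln_L assms by (simp add: mult_right_mono)
  finally have L_plus_ln_w: "L + ln w \<le> (L - ln L + 1) * (1 + w / 2)" by (simp add: algebra_simps)
  have "(1 - exp (- w)) * (L + ln w) * (1 + w / 2)
      \<le> ((1 + w / 2) * (1 - exp (- w))) * ((L - ln L + 1) * (1 + w / 2))"
    using L_plus_ln_w assms by (simp add: mult_right_mono mult_left_mono mult.commute mult.left_commute)
  also have "\<dots> \<le> w * ((L - ln L + 1) * (1 + w / 2))"
    using one_minus_exp_pade_le ln_L assms by (intro mult_right_mono) auto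
  also have "\<dots> = ((L - ln L + 1) * w) * (1 + w / 2)" by (simp only: mult_ac)
  finally show ?thesis using assms by (simp add: mult_le_cancel_right)
qed

definition bin_div :: "real \<Rightarrow> real \<Rightarrow> real" where
  "bin_div q r = q * ln (q / r) + (1 - q) * ln ((1 - q) / (1 - r))"

lemma mult_ln_div_le:
  fixes q r :: real
  assumes "0 \<le> q" "0 < r"
  shows "q * ln (q / r) \<le> q * (q / r - 1)"
proof (cases "q = 0")
  case False
  hence "ln (q / r) \<le> q / r - 1" using assms by (intro ln_le_minus_one) simp
  thus ?thesis using assms by (intro mult_left_mono) auto
qed simp

lemma bin_div_le_chi_square:
  fixes q r :: real
  assumes "0 \<le> q" "q \<le> 1" "0 < r" "r < 1"
  shows "bin_div q r \<le> (q - r)\<^sup>2 / (r * (1 - r))"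
proof -
  have "q * (q / r - 1) + (1 - q) * ((1 - q) / (1 - r) - 1) = (q - r)\<^sup>2 / (r * (1 - r))"
    using assms by (simp add: field_simps power2_eq_square)
  thus ?thesis
    using mult_ln_div_le[of q r] mult_ln_div_le[of "1 - q" "1 - r"] assms
    unfolding bin_div_def by linarith
qed

lemma bin_div_le_of_chi_square_le:
  fixes q r X :: real
  assumes "0 \<le> q" "q \<le> 1" "0 < r" "r < 1" "(q - r)\<^sup>2 \<le> X * (r * (1 - r))"
  shows "bin_div q r \<le> X"
proof -
  have "0 < r * (1 - r)" using assms by simp
  hence "(q - r)\<^sup>2 / (r * (1 - r)) \<le> X" using assms(5) by (simp add: pos_divide_le_eq)
  thus ?thesis using bin_div_le_chi_square[OF assms(1-4)] by linarith
qed

text \<open>One channel use with displacement of modulus \<open>c\<close> and detected amplitude of modulus \<open>v\<close>: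
  the click probability is \<open>Q\<close>, and \<open>R\<close> is the click probability of the reference output law,
  whose no-click probability \<open>(1 - E) e\<^sup>-\<^sup>u\<close> does not depend on the input.
  The constants \<open>2000\<close> and \<open>300\<close> are generous; they only keep the case estimates elementary.\<close>

locale click_divergence =
  fixes E c v :: real
  assumes E_pos: "0 < E" and ln_inv_E_ge: "2000 \<le> ln (1 / E)"
    and c_nonneg: "0 \<le> c" and v_nonneg: "0 \<le> v"
  fixes L u w Q R b s :: real
  defines "L \<equiv> ln (1 / E)" and "u \<equiv> c\<^sup>2" and "w \<equiv> v\<^sup>2"
    and "Q \<equiv> 1 - exp (- w)" and "R \<equiv> 1 - (1 - E) * exp (- u)"
    and "b \<equiv> L - ln L + 300" and "s \<equiv> (v - c)\<^sup>2"
begin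

lemma L_ge: "2000 \<le> L"
  using ln_inv_E_ge unfolding L_def .

lemma E_le_half: "E \<le> 1/2"
proof -
  have "ln (1 / E) \<le> 1 / E - 1" using E_pos by (intro ln_le_minus_one) simp
  hence "2001 \<le> 1 / E" using ln_inv_E_ge by linarith
  thus ?thesis using E_pos by (simp add: field_simps)
qed

lemma ln_L_nonneg: "0 \<le> ln L"
  using L_ge by simp

lemma ln_L_le: "ln L \<le> L / 8 + 2"
  using ln_le_div_add_ln_minus_one[of L 8] ln_power_two_le[of 3] L_ge by simp

lemma b_ge: "300 \<le> b"
  using ln_L_le L_ge unfolding b_def by simp

lemma u_nonneg: "0 \<le> u" and w_nonneg: "0 \<le> w" and s_nonneg: "0 \<le> s"
  unfolding u_def w_def s_def by simp_all

lemma Q_nonneg: "0 \<le> Q" and Q_le_1: "Q \<le> 1" and Q_le_w: "Q \<le> w"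
  using w_nonneg one_minus_exp_minus_le[of w] unfolding Q_def by simp_all

lemma one_minus_R: "1 - R = (1 - E) * exp (- u)"
  unfolding R_def by simp

lemma E_le_R: "E \<le> R"
proof -
  have "(1 - E) * exp (- u) \<le> (1 - E) * 1" using u_nonneg E_le_half by (intro mult_left_mono) auto
  thus ?thesis unfolding R_def by simp
qed

lemma R_pos: "0 < R"
  using E_le_R E_pos by simp

lemma R_less_1: "R < 1"
  using E_pos E_le_half unfolding R_def by simp

lemma one_minus_exp_u_le_R: "1 - exp (- u) \<le> R"
proof -
  have "(1 - E) * exp (- u) \<le> 1 * exp (- u)" using E_pos by (intro mult_right_mono) auto
  thus ?thesis unfolding R_def by simp
qed

lemma u_exp_u_le_R: "u * exp (- u) \<le> R"
  using mult_exp_minus_le_one_minus_exp[of u] one_minus_exp_u_le_R by linarith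

lemma bin_div_eq: "bin_div Q R = Q * ln (Q / R) + exp (- w) * (u - w - ln (1 - E))"
proof -
  have "1 - Q = exp (- w)" unfolding Q_def by simp
  moreover have "ln ((1 - Q) / (1 - R)) = u - w - ln (1 - E)"
    using E_pos E_le_half unfolding one_minus_R Q_def by (simp add: ln_div ln_mult)
  ultimately show ?thesis unfolding bin_div_def by simp
qed

lemma second_term_le: "exp (- w) * (u - w - ln (1 - E)) \<le> exp (- w) * (u - w) + 2 * E"
proof -
  have "exp (- w) * (- ln (1 - E)) \<le> 1 * (2 * E)"
    using minus_ln_one_minus_le[OF E_pos E_le_half] w_nonneg E_pos E_le_half
    by (intro mult_mono) auto
  thus ?thesis by (simp add: algebra_simps)
qed

lemma u_exp_sq_le_variance: "(1/2) * (u * (exp (- u))\<^sup>2) \<le> R * (1 - R)"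
proof -
  have "(1/2) * (u * (exp (- u))\<^sup>2) = (u * exp (- u)) * ((1/2) * exp (- u))"
    by (simp add: power2_eq_square)
  also have "\<dots> \<le> R * ((1 - E) * exp (- u))"
    using u_exp_u_le_R E_le_half R_pos by (intro mult_mono) auto
  finally show ?thesis using one_minus_R by simp
qed

lemma E_exp_sq_le_variance: "(E * exp (- u))\<^sup>2 \<le> 2 * E * (R * (1 - R))"
proof -
  have "E * exp (- u) \<le> E * 1" using u_nonneg E_pos by (intro mult_left_mono) auto
  also have "\<dots> \<le> R * 1" using E_le_R by simp
  also have "\<dots> \<le> R * (2 * (1 - E))" using R_pos E_le_half by (intro mult_left_mono) auto
  finally have E_exp_le: "E * exp (- u) \<le> R * (2 * (1 - E))" .
  have "(E * exp (- u))\<^sup>2 \<le> (R * (2 * (1 - E))) * (E * exp (- u))"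
    using E_exp_le E_pos unfolding power2_eq_square by (intro mult_right_mono) auto
  also have "\<dots> = 2 * E * (R * (1 - R))" by (simp add: one_minus_R algebra_simps)
  finally show ?thesis .
qed

lemma w_le_u_iff: "w \<le> u \<longleftrightarrow> v \<le> c" and u_le_w_iff: "u \<le> w \<longleftrightarrow> c \<le> v"
  unfolding u_def w_def using c_nonneg v_nonneg by (simp_all add: power_mono_iff)

lemma u_minus_w_sq: "(u - w)\<^sup>2 = s * (c + v)\<^sup>2"
  unfolding u_def w_def s_def by (simp add: power2_eq_square algebra_simps)

lemma bin_div_le_via_terms:
  assumes "Q * ln (Q / R) + exp (- w) * (u - w) \<le> b * s"
  shows "bin_div Q R \<le> 300 * E + b * s"
  using bin_div_eq second_term_le assms E_pos by linarith

lemma bin_div_le_via_chi_square: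
  assumes "(Q - R)\<^sup>2 \<le> (K * s + 4 * E) * (R * (1 - R))" and "K \<le> 300"
  shows "bin_div Q R \<le> 300 * E + b * s"
proof -
  have "bin_div Q R \<le> K * s + 4 * E"
    using assms(1) Q_nonneg Q_le_1 R_pos R_less_1 by (intro bin_div_le_of_chi_square_le) auto
  moreover have "K * s \<le> b * s" using assms(2) b_ge s_nonneg by (intro mult_right_mono) auto
  ultimately show ?thesis using E_pos by linarith
qed

lemma exp_w_mult_u_minus_w_le:
  assumes "w \<le> u - 1"
  shows "exp (- w) * (u - w) \<le> 9 * s"
proof -
  have v_le_c: "v \<le> c" using assms w_le_u_iff by simp
  have u_minus_w: "u - w = (c - v) * (c + v)"
    unfolding u_def w_def by (simp add: power2_eq_square algebra_simps)
  have s_eq: "s = (c - v) * (c - v)" unfolding s_def by (simp add: power2_eq_square algebra_simps)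
  show ?thesis
  proof (cases "2 * v \<le> c")
    case True
    have "exp (- w) * (u - w) \<le> 1 * (u - w)" using assms w_nonneg by (intro mult_right_mono) auto
    also have "\<dots> \<le> (c - v) * (3 * (c - v))"
      unfolding u_minus_w using True v_le_c by (simp add: mult_left_mono)
    also have "\<dots> = 3 * s" unfolding s_eq by simp
    finally show ?thesis using s_nonneg by linarith
  next
    case False
    text \<open>Now \<open>(c + v)\<^sup>2 \<le> 9 w\<close> and \<open>w e\<^sup>-\<^sup>w \<le> 1 \<le> u - w\<close>,
      so \<open>e\<^sup>-\<^sup>w (c + v) \<le> 9 (c - v)\<close>.\<close>
    have pos: "0 < c + v" using False v_nonneg c_nonneg by linarith
    have "(c + v)\<^sup>2 \<le> (3 * v)\<^sup>2" using False pos by (intro power_mono) auto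
    hence "exp (- w) * (c + v)\<^sup>2 \<le> 9 * (w * exp (- w))"
      unfolding w_def by (simp add: power2_eq_square mult_left_mono)
    also have "w * exp (- w) \<le> 1"
      using exp_ge_add_one_self[of w] by (simp add: exp_minus field_simps del: exp_ge_add_one_self)
    also have "9 * 1 \<le> 9 * ((c - v) * (c + v))" using assms u_minus_w by simp
    finally have "(exp (- w) * (c + v)) * (c + v) \<le> (9 * (c - v)) * (c + v)"
      by (simp add: power2_eq_square algebra_simps)
    hence "exp (- w) * (c + v) \<le> 9 * (c - v)" using pos by (simp add: mult_le_cancel_right)
    hence "(exp (- w) * (c + v)) * (c - v) \<le> (9 * (c - v)) * (c - v)"
      using v_le_c by (intro mult_right_mono) auto
    thus ?thesis unfolding u_minus_w s_eq by (simp add: algebra_simps)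
  qed
qed

lemma bin_div_le_if_w_le_u_minus_1:
  assumes "w \<le> u - 1"
  shows "bin_div Q R \<le> 300 * E + b * s"
proof (rule bin_div_le_via_terms)
  have "exp (- u) \<le> exp (- w)" using assms by simp
  hence "Q \<le> R" using one_minus_exp_u_le_R unfolding Q_def by linarith
  hence "Q * ln (Q / R) \<le> 0"
    using Q_nonneg R_pos by (cases "Q = 0") (auto simp: mult_nonneg_nonpos)
  moreover have "9 * s \<le> b * s" using b_ge s_nonneg by (intro mult_right_mono) auto
  ultimately show "Q * ln (Q / R) + exp (- w) * (u - w) \<le> b * s"
    using exp_w_mult_u_minus_w_le[OF assms] by linarith
qed

lemma bin_div_le_if_v_le_c:
  assumes "u - 1 < w" "v \<le> c"
  shows "bin_div Q R \<le> 300 * E + b * s"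
proof (rule bin_div_le_via_chi_square)
  have w_le_u: "w \<le> u" using assms w_le_u_iff by simp
  define A where "A = exp (- w) - exp (- u)"
  have A_bounds: "0 \<le> A" "A \<le> exp (- w) * (u - w)"
    using exp_minus_diff_le[OF w_le_u] w_le_u unfolding A_def by simp_all
  have "(Q - R)\<^sup>2 = (A + E * exp (- u))\<^sup>2"
    unfolding A_def Q_def R_def by (simp add: power2_eq_square algebra_simps)
  also have "\<dots> \<le> 2 * A\<^sup>2 + 2 * (E * exp (- u))\<^sup>2"
    using sum_squares_ge_zero[of "A - E * exp (- u)" 0] by (simp add: power2_eq_square algebra_simps)
  finally have sq: "(Q - R)\<^sup>2 \<le> 2 * A\<^sup>2 + 2 * (E * exp (- u))\<^sup>2" .
  have "(c + v)\<^sup>2 \<le> (2 * c)\<^sup>2" using assms(2) c_nonneg v_nonneg by (intro power_mono) auto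
  hence "(u - w)\<^sup>2 \<le> s * (4 * u)"
    unfolding u_minus_w_sq using s_nonneg by (simp add: u_def power2_eq_square mult_left_mono)
  moreover have "exp (- w) \<le> 3 * exp (- u)"
  proof -
    have "exp (u - w) \<le> exp 1" using assms(1) by simp
    hence "exp (u - w) \<le> 3" using exp_le by linarith
    thus ?thesis by (simp add: exp_diff exp_minus field_simps)
  qed
  ultimately have "(exp (- w))\<^sup>2 * (u - w)\<^sup>2 \<le> (3 * exp (- u))\<^sup>2 * (s * (4 * u))"
    by (intro mult_mono power_mono) auto
  moreover have "A\<^sup>2 \<le> (exp (- w))\<^sup>2 * (u - w)\<^sup>2"
    using A_bounds by (simp add: power_mono flip: power_mult_distrib)
  ultimately have "A\<^sup>2 \<le> (3 * exp (- u))\<^sup>2 * (s * (4 * u))" by linarith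
  also have "\<dots> = 72 * s * ((1/2) * (u * (exp (- u))\<^sup>2))" by (simp add: power2_eq_square)
  also have "\<dots> \<le> 72 * s * (R * (1 - R))"
    using u_exp_sq_le_variance s_nonneg by (intro mult_left_mono) auto
  finally show "(Q - R)\<^sup>2 \<le> (144 * s + 4 * E) * (R * (1 - R))"
    using sq E_exp_sq_le_variance by (simp add: algebra_simps)
qed simp

lemma bin_div_le_if_v_le_3c:
  assumes "c \<le> v" "v \<le> 3 * c"
  shows "bin_div Q R \<le> 300 * E + b * s"
proof (rule bin_div_le_via_chi_square)
  have u_le_w: "u \<le> w" using assms u_le_w_iff by simp
  have sq: "(Q - R)\<^sup>2 \<le> (exp (- u) * (w - u))\<^sup>2 + (E * exp (- u))\<^sup>2"
  proof (cases "R \<le> Q")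
    case True
    have "Q - R \<le> exp (- u) - exp (- w)" using E_pos unfolding Q_def R_def by simp
    also have "\<dots> \<le> exp (- u) * (w - u)" using exp_minus_diff_le[OF u_le_w] .
    finally have "(Q - R)\<^sup>2 \<le> (exp (- u) * (w - u))\<^sup>2" using True by (intro power_mono) auto
    thus ?thesis by (simp add: add_increasing2)
  next
    case False
    have "R - Q = exp (- w) - exp (- u) + E * exp (- u)"
      unfolding Q_def R_def by (simp add: algebra_simps)
    moreover have "exp (- w) \<le> exp (- u)" using u_le_w by simp
    ultimately have "(R - Q)\<^sup>2 \<le> (E * exp (- u))\<^sup>2" using False by (intro power_mono) auto
    thus ?thesis by (simp add: power2_commute add_increasing)
  qed
  have "(c + v)\<^sup>2 \<le> (4 * c)\<^sup>2" using assms c_nonneg v_nonneg by (intro power_mono) auto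
  hence "s * (c + v)\<^sup>2 \<le> s * (16 * u)"
    using s_nonneg by (simp add: u_def power2_eq_square mult_left_mono)
  hence w_minus_u: "(w - u)\<^sup>2 \<le> s * (16 * u)" using u_minus_w_sq by (simp add: power2_commute)
  have "(exp (- u) * (w - u))\<^sup>2 = (exp (- u))\<^sup>2 * (w - u)\<^sup>2" by (rule power_mult_distrib)
  also have "\<dots> \<le> (exp (- u))\<^sup>2 * (s * (16 * u))" using w_minus_u by (rule mult_left_mono) simp
  also have "\<dots> = 32 * s * ((1/2) * (u * (exp (- u))\<^sup>2))" by simp
  also have "\<dots> \<le> 32 * s * (R * (1 - R))"
    using u_exp_sq_le_variance s_nonneg by (intro mult_left_mono) auto
  moreover have "0 \<le> E * (R * (1 - R))" using E_pos R_pos R_less_1 by simp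
  ultimately show "(Q - R)\<^sup>2 \<le> (32 * s + 4 * E) * (R * (1 - R))"
    using sq E_exp_sq_le_variance unfolding distrib_right by linarith
qed simp

lemma bin_div_le_if_c_ge_1:
  assumes "3 * c < v" "1 \<le> c"
  shows "bin_div Q R \<le> 300 * E + b * s"
proof (rule bin_div_le_via_terms)
  have "1 \<le> u" using assms(2) unfolding u_def by (simp add: one_le_power)
  hence "exp (- u) \<le> exp (- 1)" by simp
  also have "exp (- 1) \<le> (1/2 :: real)"
    using exp_ge_add_one_self[of 1] by (simp add: exp_minus field_simps)
  finally have "exp (- u) \<le> 1/2" .
  hence "Q / R \<le> 2" using one_minus_exp_u_le_R Q_le_1 R_pos by (simp add: divide_le_eq)
  hence "Q * (Q / R - 1) \<le> Q * 1" using Q_nonneg by (intro mult_left_mono) auto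
  hence "Q * ln (Q / R) \<le> 1" using mult_ln_div_le[OF Q_nonneg R_pos] Q_le_1 by linarith
  moreover have "exp (- w) * (u - w) \<le> 0"
    using assms u_le_w_iff by (simp add: mult_nonneg_nonpos)
  moreover have "2\<^sup>2 \<le> s" unfolding s_def using assms by (intro power_mono) auto
  hence "300 * 4 \<le> b * s" using b_ge by (intro mult_mono) auto
  ultimately show "Q * ln (Q / R) + exp (- w) * (u - w) \<le> b * s" by linarith
qed

lemma s_ge_if_3c_less_v: "3 * c < v \<Longrightarrow> (4/9) * w \<le> s"
  using power_mono[of "2 * v / 3" "v - c" 2] v_nonneg
  unfolding s_def w_def by (simp add: power2_eq_square)

lemma ln_w_div_R_le:
  assumes "3 * c < v" "c < 1" "v \<le> c * L"
  shows "ln (w / R) \<le> 2 + 2 * ln L"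
proof -
  have "0 < c"
  proof (rule ccontr)
    assume "\<not> 0 < c"
    hence "c = 0" using c_nonneg by simp
    thus False using assms(1,3) by simp
  qed
  hence u_pos: "0 < u" and w_pos: "0 < w"
    using assms(1) c_nonneg unfolding u_def w_def by auto
  have "u \<le> 1" unfolding u_def using assms(2) c_nonneg by (simp add: power_le_one)
  hence "1/3 \<le> exp (- u)" using exp_le by (simp add: exp_minus field_simps order.trans[of _ "exp 1"])
  hence "u / 3 \<le> R" using u_exp_u_le_R mult_left_mono[OF _ u_nonneg, of "1/3" "exp (- u)"] by simp
  hence "w / R \<le> w / (u / 3)" using u_pos w_pos by (intro divide_left_mono) auto
  also have "\<dots> \<le> 3 * L\<^sup>2"
    using power_mono[OF assms(3) v_nonneg, of 2] u_pos
    unfolding u_def w_def by (simp add: power_mult_distrib divide_le_eq mult.commute)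
  finally have "ln (w / R) \<le> ln (3 * L\<^sup>2)" using w_pos R_pos by (intro ln_mono) auto
  also have "\<dots> = ln 3 + 2 * ln L" using L_ge by (simp add: ln_mult ln_realpow)
  finally show ?thesis using ln_le_minus_one[of 3] by simp
qed

lemma bin_div_le_if_v_le_cL:
  assumes "3 * c < v" "c < 1" "v \<le> c * L"
  shows "bin_div Q R \<le> 300 * E + b * s"
proof (rule bin_div_le_via_terms)
  have "Q * ln (Q / R) \<le> w * (2 + 2 * ln L)"
  proof (cases "Q = 0")
    case True
    thus ?thesis using w_nonneg ln_L_nonneg by simp
  next
    case False
    hence "ln (Q / R) \<le> ln (w / R)"
      using Q_nonneg Q_le_w R_pos by (intro ln_mono divide_right_mono) auto
    hence "Q * ln (Q / R) \<le> Q * (2 + 2 * ln L)"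
      using ln_w_div_R_le[OF assms] Q_nonneg by (intro mult_left_mono) auto
    also have "\<dots> \<le> w * (2 + 2 * ln L)" using Q_le_w ln_L_nonneg by (intro mult_right_mono) auto
    finally show ?thesis .
  qed
  also have "\<dots> \<le> b * ((4/9) * w)"
  proof -
    have "9 * (2 + 2 * ln L) \<le> 4 * b" using ln_L_le L_ge unfolding b_def by simp
    hence "(9 * (2 + 2 * ln L)) * w \<le> (4 * b) * w" using w_nonneg by (intro mult_right_mono)
    thus ?thesis by (simp add: algebra_simps)
  qed
  also have "\<dots> \<le> b * s" using s_ge_if_3c_less_v[OF assms(1)] b_ge by (intro mult_left_mono) auto
  finally show "Q * ln (Q / R) + exp (- w) * (u - w) \<le> b * s"
    using assms(1) c_nonneg u_le_w_iff by (simp add: mult_nonneg_nonpos add_decreasing2)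
qed

lemma s_ge_if_cL_less_v: "c * L < v \<Longrightarrow> w - 2 * w / L \<le> s"
proof -
  assume "c * L < v"
  hence "c \<le> v / L" using L_ge by (simp add: field_simps)
  hence "v * c \<le> v * (v / L)" using v_nonneg by (intro mult_left_mono)
  hence "2 * (v * c) \<le> 2 * w / L" unfolding w_def by (simp add: power2_eq_square)
  moreover have "s = w - 2 * (v * c) + c\<^sup>2" unfolding s_def w_def by (simp add: power2_eq_square algebra_simps)
  ultimately show ?thesis by (simp add: add_increasing2)
qed

lemma bin_div_le_if_v_gt_cL:
  assumes "3 * c < v" "c * L < v"
  shows "bin_div Q R \<le> 300 * E + b * s"
proof (rule bin_div_le_via_terms)
  have w_pos: "0 < w" using assms(1) c_nonneg unfolding w_def by simp
  have "Q * ln (Q / R) \<le> Q * (L + ln w)"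
  proof (cases "Q = 0")
    case False
    hence "Q / R \<le> w / E" using Q_nonneg Q_le_w R_pos E_le_R E_pos by (intro frac_le) auto
    hence "ln (Q / R) \<le> ln (w / E)" using False Q_nonneg R_pos by (intro ln_mono) auto
    also have "ln (w / E) = L + ln w" using E_pos w_pos unfolding L_def by (simp add: ln_div)
    finally show ?thesis using Q_nonneg by (intro mult_left_mono)
  qed simp
  also have "\<dots> \<le> (L - ln L + 1) * w"
    using one_minus_exp_mult_ln_le[OF w_pos] L_ge unfolding Q_def by simp
  also have "\<dots> = b * w - 299 * w" unfolding b_def by (simp add: algebra_simps)
  also have "\<dots> \<le> b * w - (2 * b / L) * w"
  proof -
    have "2 * b \<le> 299 * L" using ln_L_nonneg L_ge unfolding b_def by argo
    hence "2 * b / L \<le> 299" using L_ge by (simp add: divide_le_eq)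
    thus ?thesis using w_nonneg mult_right_mono[of "2 * b / L" 299 w] by linarith
  qed
  also have "\<dots> = b * (w - 2 * w / L)" by (simp add: algebra_simps)
  also have "\<dots> \<le> b * s" using s_ge_if_cL_less_v[OF assms(2)] b_ge by (intro mult_left_mono) auto
  finally show "Q * ln (Q / R) + exp (- w) * (u - w) \<le> b * s"
    using assms(1) c_nonneg u_le_w_iff by (simp add: mult_nonneg_nonpos add_decreasing2)
qed

lemma bin_div_le: "bin_div Q R \<le> 300 * E + b * s"
proof -
  consider "w \<le> u - 1" | "u - 1 < w" "v \<le> c" | "c \<le> v" "v \<le> 3 * c"
    | "3 * c < v" "1 \<le> c" | "3 * c < v" "c < 1" "v \<le> c * L" | "3 * c < v" "c * L < v"
    by linarith
  thus ?thesis
    using bin_div_le_if_w_le_u_minus_1 bin_div_le_if_v_le_c bin_div_le_if_v_le_3c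
      bin_div_le_if_c_ge_1 bin_div_le_if_v_le_cL bin_div_le_if_v_gt_cL
    by cases blast+
qed

end

lemma bin_div_click_le:
  fixes E c v :: real
  assumes "0 < E" "2000 \<le> ln (1 / E)" "0 \<le> c" "0 \<le> v"
  shows "bin_div (1 - exp (- v\<^sup>2)) (1 - (1 - E) * exp (- c\<^sup>2))
           \<le> 300 * E + (ln (1 / E) - ln (ln (1 / E)) + 300) * (v - c)\<^sup>2"
  using click_divergence.bin_div_le[OF click_divergence.intro[OF assms]] .

text \<open>A kernel maps the history of previous output bits to the law of the next bit.\<close>

definition path_prob :: "(bool list \<Rightarrow> bool \<Rightarrow> real) \<Rightarrow> bool list \<Rightarrow> real" where
  "path_prob k ys = (\<Prod>i<length ys. k (take i ys) (ys ! i))"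

definition stochastic_kernel :: "(bool list \<Rightarrow> bool \<Rightarrow> real) \<Rightarrow> bool" where
  "stochastic_kernel k \<longleftrightarrow> (\<forall>zs. (\<forall>y. 0 \<le> k zs y) \<and> k zs True + k zs False = 1)"

definition step_div :: "(bool list \<Rightarrow> bool \<Rightarrow> real) \<Rightarrow> (bool list \<Rightarrow> bool \<Rightarrow> real) \<Rightarrow> bool list \<Rightarrow> real" where
  "step_div k k' zs =
     k zs True * ln (k zs True / k' zs True) + k zs False * ln (k zs False / k' zs False)"

definition path_div :: "(bool list \<Rightarrow> bool \<Rightarrow> real) \<Rightarrow> (bool list \<Rightarrow> bool \<Rightarrow> real) \<Rightarrow> nat \<Rightarrow> real" where
  "path_div k k' N =
     (\<Sum>ys\<in>{ys. length ys = N}. path_prob k ys * ln (path_prob k ys / path_prob k' ys))"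

lemma path_prob_Nil [simp]: "path_prob k [] = 1"
  unfolding path_prob_def by simp

lemma path_prob_Cons: "path_prob k (y # zs) = k [] y * path_prob (\<lambda>ws. k (y # ws)) zs"
  unfolding path_prob_def length_Cons prod.lessThan_Suc_shift by simp

lemma lists_length_0: "{ys :: 'a list. length ys = 0} = {[]}"
  by auto

lemma sum_lists_length_Suc:
  "(\<Sum>ys\<in>{ys :: bool list. length ys = Suc N}. f ys)
     = (\<Sum>zs\<in>{zs. length zs = N}. f (True # zs)) + (\<Sum>zs\<in>{zs. length zs = N}. f (False # zs))"
proof -
  have lists: "{ys :: bool list. length ys = Suc N} = (\<lambda>(y, zs). y # zs) ` (UNIV \<times> {zs. length zs = N})"
    by (auto simp: length_Suc_conv image_iff)
  have inj: "inj_on (\<lambda>(y, zs). y # zs) (UNIV \<times> {zs :: bool list. length zs = N})"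
    by (auto simp: inj_on_def)
  have "(\<Sum>ys\<in>{ys :: bool list. length ys = Suc N}. f ys)
      = (\<Sum>p\<in>UNIV \<times> {zs. length zs = N}. f (fst p # snd p))"
    unfolding lists by (subst sum.reindex[OF inj]) (simp add: case_prod_beta)
  also have "\<dots> = (\<Sum>y\<in>UNIV. \<Sum>zs\<in>{zs. length zs = N}. f (y # zs))"
    by (subst sum.cartesian_product) (simp add: case_prod_beta)
  finally show ?thesis by (simp add: UNIV_bool add.commute)
qed

lemma stochastic_kernel_shift: "stochastic_kernel k \<Longrightarrow> stochastic_kernel (\<lambda>ws. k (y # ws))"
  unfolding stochastic_kernel_def by simp

lemma path_prob_nonneg: "stochastic_kernel k \<Longrightarrow> 0 \<le> path_prob k ys"
  unfolding path_prob_def stochastic_kernel_def by (intro prod_nonneg) auto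

lemma path_prob_pos: "(\<And>zs y. 0 < k zs y) \<Longrightarrow> 0 < path_prob k ys"
  unfolding path_prob_def by (intro prod_pos) auto

lemma sum_path_prob: "stochastic_kernel k \<Longrightarrow> (\<Sum>ys\<in>{ys. length ys = N}. path_prob k ys) = 1"
proof (induction N arbitrary: k)
  case 0
  show ?case by (simp add: lists_length_0)
next
  case (Suc N)
  have "(\<Sum>ys\<in>{ys. length ys = Suc N}. path_prob k ys) = k [] True * 1 + k [] False * 1"
    unfolding sum_lists_length_Suc path_prob_Cons sum_distrib_left[symmetric]
    using Suc.IH[OF stochastic_kernel_shift[OF Suc.prems]] by simp
  also have "\<dots> = 1" using Suc.prems unfolding stochastic_kernel_def by simp
  finally show ?case .
qed

lemma mult_ln_div_mult:
  fixes a p r q :: real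
  assumes "0 \<le> a" "0 \<le> p" "0 < r" "0 < q"
  shows "(a * p) * ln ((a * p) / (r * q)) = p * (a * ln (a / r)) + a * (p * ln (p / q))"
proof (cases "a = 0 \<or> p = 0")
  case False
  hence "ln ((a * p) / (r * q)) = ln (a / r) + ln (p / q)"
    using assms by (simp add: ln_div ln_mult)
  thus ?thesis by (simp add: algebra_simps)
qed auto

lemma path_div_Suc:
  assumes k: "stochastic_kernel k" and k': "\<And>zs y. 0 < k' zs y"
  shows "path_div k k' (Suc N) = step_div k k' []
    + k [] True * path_div (\<lambda>ws. k (True # ws)) (\<lambda>ws. k' (True # ws)) N
    + k [] False * path_div (\<lambda>ws. k (False # ws)) (\<lambda>ws. k' (False # ws)) N"
proof -
  have first: "(\<Sum>zs\<in>{zs. length zs = N}. path_prob k (y # zs) * ln (path_prob k (y # zs) / path_prob k' (y # zs)))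
      = k [] y * ln (k [] y / k' [] y) + k [] y * path_div (\<lambda>ws. k (y # ws)) (\<lambda>ws. k' (y # ws)) N"
    for y
  proof -
    let ?k = "\<lambda>ws. k (y # ws)" and ?k' = "\<lambda>ws. k' (y # ws)"
    have "0 \<le> k [] y" using k unfolding stochastic_kernel_def by simp
    hence "(\<Sum>zs\<in>{zs. length zs = N}. path_prob k (y # zs) * ln (path_prob k (y # zs) / path_prob k' (y # zs)))
       = (\<Sum>zs\<in>{zs. length zs = N}. path_prob ?k zs * (k [] y * ln (k [] y / k' [] y))
            + k [] y * (path_prob ?k zs * ln (path_prob ?k zs / path_prob ?k' zs)))"
      unfolding path_prob_Cons
      using mult_ln_div_mult path_prob_nonneg[OF stochastic_kernel_shift[OF k]] path_prob_pos k'
      by (intro sum.cong) auto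
    also have "\<dots> = k [] y * ln (k [] y / k' [] y) + k [] y * path_div ?k ?k' N"
      unfolding sum.distrib sum_distrib_right[symmetric] sum_distrib_left[symmetric] path_div_def
      by (simp add: sum_path_prob[OF stochastic_kernel_shift[OF k]])
    finally show ?thesis .
  qed
  show ?thesis
    unfolding path_div_def sum_lists_length_Suc first[unfolded path_div_def] step_div_def by simp
qed

lemma path_div_le_sum:
  assumes "stochastic_kernel k" "\<And>zs y. 0 < k' zs y"
    and "\<And>zs. length zs < N \<Longrightarrow> step_div k k' zs \<le> B (length zs)"
  shows "path_div k k' N \<le> (\<Sum>i<N. B i)"
  using assms
proof (induction N arbitrary: k k' B)
  case 0
  show ?case by (simp add: path_div_def lists_length_0)
next
  case (Suc N)
  have IH: "path_div (\<lambda>ws. k (y # ws)) (\<lambda>ws. k' (y # ws)) N \<le> (\<Sum>i<N. B (Suc i))" for y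
  proof (rule Suc.IH)
    show "stochastic_kernel (\<lambda>ws. k (y # ws))" using Suc.prems(1) by (rule stochastic_kernel_shift)
    show "0 < k' (y # zs) y'" for zs y' using Suc.prems(2) .
    show "step_div (\<lambda>ws. k (y # ws)) (\<lambda>ws. k' (y # ws)) zs \<le> B (Suc (length zs))"
      if "length zs < N" for zs
      using that Suc.prems(3)[of "y # zs"] by (simp add: step_div_def)
  qed
  have k_y: "0 \<le> k [] y" for y using Suc.prems(1) unfolding stochastic_kernel_def by simp
  have "path_div k k' (Suc N) \<le> B 0 + k [] True * (\<Sum>i<N. B (Suc i)) + k [] False * (\<Sum>i<N. B (Suc i))"
    unfolding path_div_Suc[OF Suc.prems(1,2)]
    using Suc.prems(3)[of "[]"] IH k_y by (intro add_mono mult_left_mono) auto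
  also have "\<dots> = (\<Sum>i<Suc N. B i)"
    using Suc.prems(1) unfolding stochastic_kernel_def sum.lessThan_Suc_shift
    by (simp add: distrib_right[symmetric])
  finally show ?case .
qed

lemma mult_ln_div_ge:
  fixes p q c :: real
  assumes "0 \<le> p" "0 < q" "0 < c"
  shows "p * ln c - c * q \<le> p * ln (p / q)"
proof (cases "p = 0")
  case False
  hence p_pos: "0 < p" using assms by simp
  have "p * ln (c * q / p) \<le> p * (c * q / p - 1)"
    using p_pos assms by (intro mult_left_mono ln_le_minus_one) auto
  also have "\<dots> = c * q - p" using p_pos by (simp add: field_simps)
  finally have "p * ln (c * q / p) \<le> c * q - p" .
  moreover have "ln (p / q) = ln c - ln (c * q / p)" using p_pos assms by (simp add: ln_div ln_mult)
  ultimately show ?thesis using p_pos by (simp add: right_diff_distrib)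
qed (use assms in simp)

text \<open>Change of measure from the output laws \<open>P m\<close> to a single law \<open>Q\<close> that ignores the message:
  \<open>Q\<close> assigns total mass at most \<open>1\<close> to the correct-decoding events.\<close>

lemma decoding_success_le:
  fixes P :: "nat \<Rightarrow> 'a \<Rightarrow> real" and Q :: "'a \<Rightarrow> real" and dec :: "'a \<Rightarrow> nat" and M :: nat
  assumes "finite Y" and P_nonneg: "\<And>m y. 0 \<le> P m y" and Q_pos: "\<And>y. 0 < Q y"
    and Q_sum: "(\<Sum>y\<in>Y. Q y) = 1" and "0 < M"
  shows "(\<Sum>m<M. \<Sum>y\<in>Y. P m y * (if dec y = m then 1 else 0)) * ln M
           \<le> (\<Sum>m<M. \<Sum>y\<in>Y. P m y * ln (P m y / Q y)) + 2 * M"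
proof -
  let ?t = "\<lambda>m y. if dec y = m then P m y * ln M - M * Q y else - Q y"
  have hits: "(\<Sum>m<M. \<Sum>y\<in>Y. if dec y = m then Q y else 0) \<le> 1"
  proof -
    have "(\<Sum>m<M. \<Sum>y\<in>Y. if dec y = m then Q y else 0) = (\<Sum>y\<in>Y. if dec y < M then Q y else 0)"
      by (subst sum.swap) (simp add: sum.delta)
    also have "\<dots> \<le> (\<Sum>y\<in>Y. Q y)" using Q_pos by (intro sum_mono) (simp add: less_imp_le)
    finally show ?thesis using Q_sum by simp
  qed
  have misses: "(\<Sum>m<M. \<Sum>y\<in>Y. if dec y = m then 0 else Q y) \<le> M"
  proof -
    have "(\<Sum>m<M. \<Sum>y\<in>Y. if dec y = m then 0 else Q y) \<le> (\<Sum>m<M. \<Sum>y\<in>Y. Q y)"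
      using Q_pos by (intro sum_mono) (simp add: less_imp_le)
    thus ?thesis using Q_sum by simp
  qed
  have "(\<Sum>m<M. \<Sum>y\<in>Y. ?t m y)
      = (\<Sum>m<M. \<Sum>y\<in>Y. P m y * (if dec y = m then 1 else 0)) * ln M
        - M * (\<Sum>m<M. \<Sum>y\<in>Y. if dec y = m then Q y else 0)
        - (\<Sum>m<M. \<Sum>y\<in>Y. if dec y = m then 0 else Q y)"
    unfolding sum_distrib_left sum_distrib_right sum_subtractf[symmetric]
    by (intro sum.cong) auto
  moreover have "M * (\<Sum>m<M. \<Sum>y\<in>Y. if dec y = m then Q y else 0) \<le> real M * 1"
    using hits by (intro mult_left_mono) auto
  ultimately have "(\<Sum>m<M. \<Sum>y\<in>Y. P m y * (if dec y = m then 1 else 0)) * ln M - 2 * M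
      \<le> (\<Sum>m<M. \<Sum>y\<in>Y. ?t m y)"
    using misses by linarith
  also have "\<dots> \<le> (\<Sum>m<M. \<Sum>y\<in>Y. P m y * ln (P m y / Q y))"
    using mult_ln_div_ge[OF P_nonneg Q_pos] \<open>0 < M\<close> mult_ln_div_ge[OF P_nonneg Q_pos, of 1]
    by (intro sum_mono) auto
  finally show ?thesis by simp
qed

definition channel_kernel :: "(nat \<Rightarrow> complex) \<Rightarrow> (bool list \<Rightarrow> complex) \<Rightarrow> bool list \<Rightarrow> bool \<Rightarrow> real" where
  "channel_kernel x l zs y = p_out (x (length zs)) (l zs) y"

definition reference_kernel :: "real \<Rightarrow> (bool list \<Rightarrow> complex) \<Rightarrow> bool list \<Rightarrow> bool \<Rightarrow> real" where
  "reference_kernel E l zs y =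
     (if y then 1 - (1 - E) * exp (- (cmod (l zs))\<^sup>2) else (1 - E) * exp (- (cmod (l zs))\<^sup>2))"

lemma seq_prob_eq_path_prob: "seq_prob x l = path_prob (channel_kernel x l)"
  unfolding seq_prob_def path_prob_def channel_kernel_def by (simp add: fun_eq_iff)

lemma stochastic_channel_kernel: "stochastic_kernel (channel_kernel x l)"
  unfolding stochastic_kernel_def channel_kernel_def p_out_def by auto

lemma reference_kernel_pos:
  assumes "0 < E" "E < 1"
  shows "0 < reference_kernel E l zs y"
proof -
  have "(1 - E) * exp (- (cmod (l zs))\<^sup>2) \<le> 1 - E"
    using assms by (intro mult_left_le) auto
  also have "\<dots> < 1" using assms by simp
  finally have "(1 - E) * exp (- (cmod (l zs))\<^sup>2) < 1" .
  thus ?thesis using assms unfolding reference_kernel_def by auto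
qed

lemma stochastic_reference_kernel: "0 < E \<Longrightarrow> E < 1 \<Longrightarrow> stochastic_kernel (reference_kernel E l)"
  using reference_kernel_pos unfolding stochastic_kernel_def
  by (auto simp: reference_kernel_def less_imp_le)

lemma less_one_if_ln_inverse_ge:
  fixes E :: real
  assumes "0 < E" "0 \<le> a" "a < ln (1 / E)"
  shows "E < 1"
proof -
  have "ln (1 / E) = - ln E" using assms(1) by (simp add: ln_div)
  hence "ln E < 0" using assms(2,3) by linarith
  thus ?thesis using assms(1) by simp
qed

lemma step_div_channel_le:
  assumes "0 < E" "2000 \<le> ln (1 / E)"
  shows "step_div (channel_kernel x l) (reference_kernel E l) zs
           \<le> 300 * E + (ln (1 / E) - ln (ln (1 / E)) + 300) * (cmod (x (length zs)))\<^sup>2"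
proof -
  define c where "c = cmod (l zs)"
  define v where "v = cmod (x (length zs) + l zs)"
  have "0 \<le> ln (1 / E) - ln (ln (1 / E)) + 300"
    using ln_le_minus_one[of "ln (1 / E)"] assms(2) by simp
  moreover have "(v - c)\<^sup>2 \<le> (cmod (x (length zs)))\<^sup>2"
    using norm_triangle_ineq3[of "x (length zs) + l zs" "l zs"] unfolding v_def c_def
    by (simp add: power2_le_iff_abs_le)
  ultimately have "300 * E + (ln (1 / E) - ln (ln (1 / E)) + 300) * (v - c)\<^sup>2
      \<le> 300 * E + (ln (1 / E) - ln (ln (1 / E)) + 300) * (cmod (x (length zs)))\<^sup>2"
    by (simp add: mult_left_mono)
  moreover have "step_div (channel_kernel x l) (reference_kernel E l) zs
      = bin_div (1 - exp (- v\<^sup>2)) (1 - (1 - E) * exp (- c\<^sup>2))"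
    unfolding step_div_def channel_kernel_def reference_kernel_def p_out_def bin_div_def c_def v_def
    by simp
  ultimately show ?thesis using bin_div_click_le[OF assms, of c v] unfolding c_def v_def by simp
qed

lemma path_div_channel_le:
  assumes "0 < E" "2000 \<le> ln (1 / E)"
  shows "path_div (channel_kernel x l) (reference_kernel E l) N
           \<le> (\<Sum>i<N. 300 * E + (ln (1 / E) - ln (ln (1 / E)) + 300) * (cmod (x i))\<^sup>2)"
  using assms less_one_if_ln_inverse_ge[OF assms(1), of 1999]
  by (intro path_div_le_sum stochastic_channel_kernel reference_kernel_pos step_div_channel_le) auto

lemma ln_num_msgs_ge: "real N * R \<le> ln (real (num_msgs N R))" and num_msgs_pos: "0 < num_msgs N R"
proof -
  have "exp (real N * R) \<le> real (num_msgs N R)"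
    unfolding num_msgs_def by (simp add: of_nat_nat le_of_int_ceiling order.trans[OF _ le_of_int_ceiling])
  moreover have "0 < exp (real N * R)" by simp
  ultimately have "0 < real (num_msgs N R)" by (rule order.strict_trans2[rotated])
  thus "0 < num_msgs N R" by simp
  show "real N * R \<le> ln (real (num_msgs N R))"
    using ln_mono[OF \<open>exp (real N * R) \<le> real (num_msgs N R)\<close> exp_gt_zero] by simp
qed

lemma sum_path_div_channel_le:
  assumes "0 < E" "2000 \<le> ln (1 / E)" and valid: "valid_encoder A E N M enc" and "0 < M"
  shows "(\<Sum>m<M. path_div (channel_kernel (enc m) l) (reference_kernel E l) N)
           \<le> M * (N * (300 * E + (ln (1 / E) - ln (ln (1 / E)) + 300) * E))"
proof -
  define b where "b = ln (1 / E) - ln (ln (1 / E)) + 300"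
  have "(\<Sum>m<M. path_div (channel_kernel (enc m) l) (reference_kernel E l) N)
      \<le> (\<Sum>m<M. \<Sum>i<N. 300 * E + b * (cmod (enc m i))\<^sup>2)"
    unfolding b_def using assms by (intro sum_mono path_div_channel_le)
  also have "\<dots> = M * (N * (300 * E)) + b * (\<Sum>i<N. \<Sum>m<M. (cmod (enc m i))\<^sup>2)"
    by (simp add: sum.distrib sum_distrib_left[symmetric] sum.swap[of _ "{..<N}"])
  also have "(\<Sum>i<N. \<Sum>m<M. (cmod (enc m i))\<^sup>2) = (\<Sum>i<N. E * M)"
    using valid \<open>0 < M\<close> unfolding valid_encoder_def by (intro sum.cong) (auto simp: field_simps)
  finally show ?thesis unfolding b_def by (simp add: algebra_simps)
qed

lemma rate_bound_at_blocklength: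
  fixes E R :: real and N :: nat and enc :: "nat \<Rightarrow> nat \<Rightarrow> complex"
    and l :: "bool list \<Rightarrow> complex" and dec :: "bool list \<Rightarrow> nat"
  defines "M \<equiv> num_msgs N R" and "err \<equiv> err_prob N (num_msgs N R) enc l dec"
  assumes "0 < E" "2000 \<le> ln (1 / E)" and "valid_encoder A E N M enc" and "err \<le> 1"
  shows "(1 - err) * (real N * R) \<le> real N * (300 * E + (ln (1 / E) - ln (ln (1 / E)) + 300) * E) + 2"
proof -
  define P where "P m = seq_prob (enc m) l" for m
  define Y where "Y = {ys :: bool list. length ys = N}"
  have E_less_1: "E < 1" using assms less_one_if_ln_inverse_ge[of E 1999] by simp
  have M_pos: "0 < M" unfolding M_def by (rule num_msgs_pos)
  have P_sum: "(\<Sum>ys\<in>Y. P m ys) = 1" for m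
    unfolding P_def Y_def seq_prob_eq_path_prob by (rule sum_path_prob[OF stochastic_channel_kernel])
  have "err * M = (\<Sum>m<M. \<Sum>ys\<in>Y. P m ys * (if dec ys = m then 0 else 1))"
    using M_pos unfolding err_def err_prob_def M_def P_def Y_def by simp
  moreover have "(\<Sum>m<M. \<Sum>ys\<in>Y. P m ys * (if dec ys = m then 1 else 0))
      = (\<Sum>m<M. (\<Sum>ys\<in>Y. P m ys) - (\<Sum>ys\<in>Y. P m ys * (if dec ys = m then 0 else 1)))"
    unfolding sum_subtractf[symmetric] by (intro sum.cong) auto
  ultimately have success: "(\<Sum>m<M. \<Sum>ys\<in>Y. P m ys * (if dec ys = m then 1 else 0)) = M * (1 - err)"
    using P_sum by (simp add: sum_subtractf algebra_simps)
  have "M * (1 - err) * ln M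
      \<le> (\<Sum>m<M. \<Sum>ys\<in>Y. P m ys * ln (P m ys / path_prob (reference_kernel E l) ys)) + 2 * M"
    unfolding success[symmetric]
  proof (rule decoding_success_le)
    show "finite Y" unfolding Y_def using finite_lists_length_eq[of "UNIV :: bool set" N] by simp
    show "0 \<le> P m ys" for m ys
      unfolding P_def seq_prob_eq_path_prob by (rule path_prob_nonneg[OF stochastic_channel_kernel])
    show "0 < path_prob (reference_kernel E l) ys" for ys
      using assms(3) E_less_1 by (intro path_prob_pos reference_kernel_pos)
    show "(\<Sum>ys\<in>Y. path_prob (reference_kernel E l) ys) = 1"
      unfolding Y_def using assms(3) E_less_1 by (intro sum_path_prob stochastic_reference_kernel)
  qed (use M_pos in simp)
  also have "\<dots> \<le> M * (N * (300 * E + (ln (1 / E) - ln (ln (1 / E)) + 300) * E)) + 2 * M"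
    using sum_path_div_channel_le[OF assms(3,4,5)] M_pos
    unfolding path_div_def P_def Y_def seq_prob_eq_path_prob by simp
  finally have "M * ((1 - err) * ln M) \<le> M * (N * (300 * E + (ln (1 / E) - ln (ln (1 / E)) + 300) * E) + 2)"
    by (simp add: algebra_simps)
  hence "(1 - err) * ln M \<le> N * (300 * E + (ln (1 / E) - ln (ln (1 / E)) + 300) * E) + 2"
    using M_pos by (simp only: mult_le_cancel_left_pos of_nat_0_less_iff)
  moreover have "(1 - err) * (real N * R) \<le> (1 - err) * ln M"
    using ln_num_msgs_ge \<open>err \<le> 1\<close> unfolding M_def by (intro mult_left_mono) auto
  ultimately show ?thesis by linarith
qed
lemma rate_le_of_block_bounds:
  fixes err :: "nat \<Rightarrow> real"
  assumes "err \<longlonglongrightarrow> 0"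
    and "\<forall>\<^sub>F N in sequentially. err N \<le> 1 \<longrightarrow> (1 - err N) * (real N * R) \<le> real N * C + D"
  shows "R \<le> C"
proof (rule tendsto_le[OF sequentially_bot])
  show "(\<lambda>N. (1 - err N) * R) \<longlonglongrightarrow> R"
    using assms(1) by (auto intro!: tendsto_eq_intros)
  show "(\<lambda>N. C + D / real N) \<longlonglongrightarrow> C"
    by (auto intro!: tendsto_eq_intros lim_inverse_n')
  show "\<forall>\<^sub>F N in sequentially. (1 - err N) * R \<le> C + D / real N"
    using assms(2) eventually_gt_at_top[of 0] order_tendstoD(2)[OF assms(1) zero_less_one]
  proof eventually_elim
    case (elim N)
    hence "((1 - err N) * R) * real N \<le> (C + D / real N) * real N"
      by (simp add: algebra_simps)
    thus ?case using elim(2) by simp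
  qed
qed

theorem theorem1:
  fixes A :: "complex set"
  assumes "finite A"
  shows "\<exists>K \<delta>. \<delta> > 0 \<and> (\<forall>E R. 0 < E \<and> E < \<delta> \<and> achievable A E R \<longrightarrow>
           R / E \<le> ln (1 / E) - ln (ln (1 / E)) + K)"
proof (intro exI conjI allI impI)
  show "0 < exp (- 2000 :: real)" by simp
  fix E R :: real
  assume "0 < E \<and> E < exp (- 2000) \<and> achievable A E R"
  hence E_pos: "0 < E" and "E < exp (- 2000)" and "achievable A E R" by auto
  hence small: "2000 \<le> ln (1 / E)"
    using ln_less_cancel_iff[of E "exp (- 2000)"] by (simp add: ln_div)
  obtain enc l dec where valid: "\<forall>\<^sub>F N in sequentially. valid_encoder A E N (num_msgs N R) (enc N)"
    and err: "(\<lambda>N. err_prob N (num_msgs N R) (enc N) (l N) (dec N)) \<longlonglongrightarrow> 0"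
    using \<open>achievable A E R\<close> unfolding achievable_def by blast
  have "R \<le> 300 * E + (ln (1 / E) - ln (ln (1 / E)) + 300) * E"
  proof (rule rate_le_of_block_bounds[OF err])
    show "\<forall>\<^sub>F N in sequentially. err_prob N (num_msgs N R) (enc N) (l N) (dec N) \<le> 1 \<longrightarrow>
        (1 - err_prob N (num_msgs N R) (enc N) (l N) (dec N)) * (real N * R)
          \<le> real N * (300 * E + (ln (1 / E) - ln (ln (1 / E)) + 300) * E) + 2"
      using valid by eventually_elim (use rate_bound_at_blocklength[OF E_pos small] in blast)
  qed
  thus "R / E \<le> ln (1 / E) - ln (ln (1 / E)) + 600"
    using E_pos by (simp add: field_simps)
qed

end
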